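(* Let $a,b>0$, let $(X,d)$ be a Polish metric space, let $k\ge2$ be an integer, let $\mu_1,\dots,\mu_k$ be nonnegative finite Borel measures on $X$ with compact supports, let $\lambda_1,\dots,\lambda_k$ be positive reals with $\sum_{i=1}^k\lambda_i=1$, and let $K=\bigcup_{i=1}^k\mathrm{supp}(\mu_i)$. Then the problem $$(B^* )\qquad \sup\left\{\sum_{i=1}^k\int_K\overline{S}_{\lambda_i}f_i(x)\,d\mu_i(x) : f_i\in F_{\lambda_i}\ (1\le i\le k),\ \sum_{i=1}^kf_i=0\right\}$$ has a solution, i.e. the supremum is attained.
   Context: For $\lambda>0$, $F_\lambda:=\{f\in C_b(K): f(x)\le\lambda a\ \text{for every }x\in K\}$, where $C_b(K)$ is the space of bounded continuous real functions on $K$. For $f\in F_\lambda$ and $x\in K$, $S_\lambda f(x):=\inf_{y\in K}\{\lambda b^2d^2(x,y)-f(y)\}$ and $\overline S_\lambda f(x):=\min\{S_\lambda f(x),\lambda a\}$. *)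

theory Defs
  imports "HOL-Analysis.Analysis"
begin

definition supp :: "'a::topological_space measure \<Rightarrow> 'a set" where
  "supp M = {x. \<forall>U. open U \<and> x \<in> U \<longrightarrow> 0 < emeasure M U}"

text \<open>Functions on \<open>K\<close> are represented by total functions of which only the values on
  \<open>K\<close> are constrained or used.\<close>

definition Cb :: "'a::metric_space set \<Rightarrow> ('a \<Rightarrow> real) set" where
  "Cb K = {f. continuous_on K f \<and> bounded (f ` K)}"

definition F :: "real \<Rightarrow> 'a::metric_space set \<Rightarrow> real \<Rightarrow> ('a \<Rightarrow> real) set" where
  "F a K l = {f \<in> Cb K. \<forall>x\<in>K. f x \<le> l * a}"

text \<open>For \<open>f \<in> F a K l\<close> with \<open>l \<ge> 0\<close> and nonempty \<open>K\<close>, the infimum is taken over a nonempty set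
  of reals bounded below by \<open>- l * a\<close>, so it is a genuine infimum.\<close>

definition S :: "real \<Rightarrow> 'a::metric_space set \<Rightarrow> real \<Rightarrow> ('a \<Rightarrow> real) \<Rightarrow> 'a \<Rightarrow> real" where
  "S b K l f x = (INF y\<in>K. l * b\<^sup>2 * (dist x y)\<^sup>2 - f y)"

definition S_bar ::
    "real \<Rightarrow> real \<Rightarrow> 'a::metric_space set \<Rightarrow> real \<Rightarrow> ('a \<Rightarrow> real) \<Rightarrow> 'a \<Rightarrow> real" where
  "S_bar a b K l f x = min (S b K l f x) (l * a)"

text \<open>Families indexed by \<open>1, \<dots>, k\<close> are functions on \<open>nat\<close> whose values outside
  \<open>{1..k}\<close> are irrelevant.\<close>

definition feasible ::
    "real \<Rightarrow> 'a::metric_space set \<Rightarrow> nat \<Rightarrow> (nat \<Rightarrow> real) \<Rightarrow> (nat \<Rightarrow> 'a \<Rightarrow> real) set" where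
  "feasible a K k l =
     {f. (\<forall>i\<in>{1..k}. f i \<in> F a K (l i)) \<and> (\<forall>x\<in>K. (\<Sum>i=1..k. f i x) = 0)}"

definition objective ::
    "real \<Rightarrow> real \<Rightarrow> 'a::metric_space set \<Rightarrow> nat \<Rightarrow> (nat \<Rightarrow> 'a measure) \<Rightarrow> (nat \<Rightarrow> real)
      \<Rightarrow> (nat \<Rightarrow> 'a \<Rightarrow> real) \<Rightarrow> real" where
  "objective a b K k \<mu> l f = (\<Sum>i=1..k. (LINT x:K|\<mu> i. S_bar a b K (l i) (f i) x))"

end

theory Submission
  imports Defs
begin

text \<open>The double transform of \<open>f\<close> by \<open>S_bar\<close> dominates \<open>f\<close>, has the same transform as \<open>f\<close>,
  and is Lipschitz with a constant depending only on the diameter of \<open>K\<close>. Replacing the first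
  \<open>k - 1\<close> functions of a feasible family by their double transforms and the last one by minus
  their sum (which only decreases it) therefore does not decrease the objective, since \<open>S_bar\<close> is
  antitone. So the supremum may be taken over a uniformly bounded, equi-Lipschitz class. That class
  is compact for pointwise convergence by Tychonoff, where pointwise convergence is uniform on \<open>K\<close>;
  the objective is continuous on it because \<open>S_bar\<close> is nonexpansive in the uniform norm.\<close>

section \<open>The truncated transform\<close>

lemma S_bdd_below:
  assumes "f \<in> F a K l" "0 \<le> l"
  shows "bdd_below ((\<lambda>y. l * b\<^sup>2 * (dist x y)\<^sup>2 - f y) ` K)"
proof (rule bdd_belowI2)
  fix y assume "y \<in> K"
  then have "f y \<le> l * a" using assms by (simp add: F_def)
  moreover have "0 \<le> l * b\<^sup>2 * (dist x y)\<^sup>2" using assms by simp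
  ultimately show "- (l * a) \<le> l * b\<^sup>2 * (dist x y)\<^sup>2 - f y" by linarith
qed

lemma S_bar_upper:
  assumes "f \<in> F a K l" "0 \<le> l" "y \<in> K"
  shows "S_bar a b K l f x \<le> l * b\<^sup>2 * (dist x y)\<^sup>2 - f y"
proof -
  have "S b K l f x \<le> l * b\<^sup>2 * (dist x y)\<^sup>2 - f y"
    unfolding S_def by (rule cINF_lower[OF S_bdd_below[OF assms(1,2)] assms(3)])
  then show ?thesis by (simp add: S_bar_def)
qed

lemma S_bar_le: "S_bar a b K l f x \<le> l * a"
  by (simp add: S_bar_def)

text \<open>With \<open>S_bar_upper\<close> and \<open>S_bar_le\<close> this describes
  \<open>S_bar\<close> as a greatest lower bound; the later estimates use these three facts and
  never unfold the infimum again.\<close>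

lemma S_bar_greatest:
  assumes "K \<noteq> {}" "z \<le> l * a" "\<And>y. y \<in> K \<Longrightarrow> z \<le> l * b\<^sup>2 * (dist x y)\<^sup>2 - f y"
  shows "z \<le> S_bar a b K l f x"
  using assms by (auto simp: S_bar_def S_def intro!: cINF_greatest)

lemma S_bar_antimono:
  assumes "g \<in> F a K l" "0 \<le> l" "K \<noteq> {}" "\<And>y. y \<in> K \<Longrightarrow> f y \<le> g y"
  shows "S_bar a b K l g x \<le> S_bar a b K l f x"
proof (rule S_bar_greatest[OF assms(3) S_bar_le])
  fix y assume "y \<in> K"
  then show "S_bar a b K l g x \<le> l * b\<^sup>2 * (dist x y)\<^sup>2 - f y"
    using S_bar_upper[OF assms(1,2), of y b x] assms(4)[of y] by linarith
qed

text \<open>Raising the function by at most \<open>e\<close> lowers every competitor in the infimum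
  by at most \<open>e\<close>; the cap \<open>l * a\<close> survives because \<open>e\<close> is
  nonnegative.\<close>

lemma S_bar_nonexpansive_le:
  assumes "g \<in> F a K l" "0 \<le> l" "K \<noteq> {}" "0 \<le> e" "\<And>y. y \<in> K \<Longrightarrow> f y \<le> g y + e"
  shows "S_bar a b K l g x - e \<le> S_bar a b K l f x"
proof (rule S_bar_greatest[OF assms(3)])
  show "S_bar a b K l g x - e \<le> l * a" using S_bar_le[of a b K l g x] assms(4) by linarith
next
  fix y assume "y \<in> K"
  then show "S_bar a b K l g x - e \<le> l * b\<^sup>2 * (dist x y)\<^sup>2 - f y"
    using S_bar_upper[OF assms(1,2), of y b x] assms(5)[of y] by linarith
qed

lemma S_bar_nonexpansive:
  assumes "f \<in> F a K l" "g \<in> F a K l" "0 \<le> l" "K \<noteq> {}" "0 \<le> e"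
    and fg: "\<And>y. y \<in> K \<Longrightarrow> \<bar>f y - g y\<bar> \<le> e"
  shows "\<bar>S_bar a b K l f x - S_bar a b K l g x\<bar> \<le> e"
proof -
  have "S_bar a b K l g x - e \<le> S_bar a b K l f x"
    by (rule S_bar_nonexpansive_le[OF assms(2-5)]) (use fg in fastforce)
  moreover have "S_bar a b K l f x - e \<le> S_bar a b K l g x"
    by (rule S_bar_nonexpansive_le[OF assms(1,3-5)]) (use fg in fastforce)
  ultimately show ?thesis by linarith
qed

text \<open>Every competitor is Lipschitz in \<open>x\<close> on the bounded set \<open>K\<close>,
  with a constant that depends neither on \<open>y\<close> nor on \<open>f\<close>, and the capped
  infimum inherits it.\<close>

lemma S_bar_Lipschitz_le:
  assumes f: "f \<in> F a K l" and l: "0 \<le> l" and K: "bounded K" and x: "x \<in> K" "x' \<in> K"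
  shows "S_bar a b K l f x - l * (2 * b\<^sup>2 * diameter K) * dist x x' \<le> S_bar a b K l f x'"
proof (rule S_bar_greatest)
  let ?D = "diameter K"
  show "K \<noteq> {}" using x by auto
  have D: "0 \<le> ?D" by (rule diameter_ge_0[OF K])
  then have "0 \<le> l * (2 * b\<^sup>2 * ?D) * dist x x'" using l by simp
  then show "S_bar a b K l f x - l * (2 * b\<^sup>2 * ?D) * dist x x' \<le> l * a"
    using S_bar_le[of a b K l f x] by linarith
  fix y assume y: "y \<in> K"
  \<comment> \<open>The factor 2 in the constant arises here: the triangle inequality bounds the
    difference of the two distances, and the diameter bounds each summand of their sum.\<close>
  have "(dist x y)\<^sup>2 - (dist x' y)\<^sup>2 = (dist x y + dist x' y) * (dist x y - dist x' y)"
    by (simp add: power2_eq_square algebra_simps)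
  also have "\<dots> \<le> (dist x y + dist x' y) * dist x x'"
    by (rule mult_left_mono) (use dist_triangle[of x y x'] in auto)
  also have "\<dots> \<le> (2 * ?D) * dist x x'"
    by (rule mult_right_mono)
      (use diameter_bounded_bound[OF K x(1) y] diameter_bounded_bound[OF K x(2) y] in auto)
  finally have "l * b\<^sup>2 * ((dist x y)\<^sup>2 - (dist x' y)\<^sup>2) \<le> l * b\<^sup>2 * ((2 * ?D) * dist x x')"
    by (rule mult_left_mono) (use l in simp)
  then show "S_bar a b K l f x - l * (2 * b\<^sup>2 * ?D) * dist x x' \<le> l * b\<^sup>2 * (dist x' y)\<^sup>2 - f y"
    using S_bar_upper[OF f l y, of b x] by (simp add: algebra_simps)
qed

lemma S_bar_Lipschitz:
  assumes "f \<in> F a K l" "0 \<le> l" "bounded K" "x \<in> K" "x' \<in> K"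
  shows "\<bar>S_bar a b K l f x - S_bar a b K l f x'\<bar> \<le> l * (2 * b\<^sup>2 * diameter K) * dist x x'"
  using S_bar_Lipschitz_le[OF assms(1-3) assms(4,5), of b]
    S_bar_Lipschitz_le[OF assms(1-3) assms(5,4), of b]
  by (simp add: dist_commute abs_le_iff)

lemma continuous_on_if_Lipschitz:
  fixes f :: "'a::metric_space \<Rightarrow> real"
  assumes "\<And>x y. x \<in> K \<Longrightarrow> y \<in> K \<Longrightarrow> \<bar>f x - f y\<bar> \<le> L * dist x y" "0 \<le> L"
  shows "continuous_on K f"
  using assms
  by (intro lipschitz_on_continuous_on[of L]) (auto intro!: lipschitz_onI simp: dist_real_def)

lemma in_F_if_continuous:
  assumes "compact K" "continuous_on K f" "\<And>x. x \<in> K \<Longrightarrow> f x \<le> l * a"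
  shows "f \<in> F a K l"
  using assms by (auto simp: F_def Cb_def intro!: compact_imp_bounded compact_continuous_image)

lemma S_bar_continuous_on:
  assumes "f \<in> F a K l" "0 \<le> l" "compact K"
  shows "continuous_on K (S_bar a b K l f)"
  using S_bar_Lipschitz[OF assms(1,2) compact_imp_bounded[OF assms(3)]]
    diameter_ge_0[OF compact_imp_bounded[OF assms(3)]] assms(2)
  by (intro continuous_on_if_Lipschitz[of K _ "l * (2 * b\<^sup>2 * diameter K)"]) auto

lemma S_bar_in_F:
  assumes "f \<in> F a K l" "0 \<le> l" "compact K"
  shows "S_bar a b K l f \<in> F a K l"
  by (rule in_F_if_continuous[OF assms(3) S_bar_continuous_on[OF assms] S_bar_le])

text \<open>By symmetry of the distance, the bound of \<open>S_bar\<close> at \<open>y\<close> by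
  the competitor at \<open>x\<close> rearranges to a lower bound on each competitor of the second
  transform; membership in \<open>F\<close> handles the cap.\<close>

lemma le_S_bar_S_bar:
  assumes f: "f \<in> F a K l" and l: "0 \<le> l" and x: "x \<in> K"
  shows "f x \<le> S_bar a b K l (S_bar a b K l f) x"
proof (rule S_bar_greatest)
  show "K \<noteq> {}" using x by auto
  show "f x \<le> l * a" using f x by (simp add: F_def)
  fix y
  show "f x \<le> l * b\<^sup>2 * (dist x y)\<^sup>2 - S_bar a b K l f y"
    using S_bar_upper[OF f l x, of b y] by (simp add: dist_commute)
qed

section \<open>The objective\<close>

lemma set_integrable_continuous_compact:
  fixes f :: "'a::metric_space \<Rightarrow> real"
  assumes M: "sets M = sets borel" "finite_measure M" and K: "compact K" and f: "continuous_on K f"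
  shows "set_integrable M K f"
proof -
  interpret finite_measure M by fact
  obtain B where B: "\<And>x. x \<in> K \<Longrightarrow> norm (f x) \<le> B"
    using compact_imp_bounded[OF compact_continuous_image[OF f K]] by (auto simp: bounded_iff)
  have "(\<lambda>x. indicator K x *\<^sub>R f x) \<in> borel_measurable borel"
    by (rule borel_measurable_continuous_on_indicator[OF borel_compact[OF K] f])
  then have "(\<lambda>x. indicator K x *\<^sub>R f x) \<in> borel_measurable M"
    by (simp add: measurable_cong_sets[OF M(1) refl])
  \<comment> \<open>The maximum with 0 covers the points off \<open>K\<close>, where the integrand
    vanishes: \<open>B\<close> may be negative if \<open>K\<close> is empty.\<close>
  moreover have "AE x in M. norm (indicator K x *\<^sub>R f x) \<le> max 0 B"
    by (rule AE_I2) (use B in \<open>fastforce simp: indicator_def\<close>)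
  ultimately show ?thesis
    unfolding set_integrable_def by (rule integrable_const_bound[rotated])
qed

lemma set_integral_diff_bound:
  fixes u v :: "'a::metric_space \<Rightarrow> real"
  assumes M: "sets M = sets borel" "finite_measure M" and K: "compact K"
    and uv: "continuous_on K u" "continuous_on K v"
    and e: "0 \<le> e" "\<And>x. x \<in> K \<Longrightarrow> \<bar>u x - v x\<bar> \<le> e"
  shows "\<bar>(LINT x:K|M. u x) - (LINT x:K|M. v x)\<bar> \<le> e * measure M (space M)"
proof -
  interpret finite_measure M by fact
  note int = set_integrable_continuous_compact[OF M K]
  have "\<bar>(LINT x:K|M. u x) - (LINT x:K|M. v x)\<bar> = \<bar>LINT x:K|M. u x - v x\<bar>"
    by (simp add: set_integral_diff int uv)
  also have "\<dots> \<le> (LINT x|M. \<bar>indicator K x *\<^sub>R (u x - v x)\<bar>)"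
    unfolding set_lebesgue_integral_def by (rule integral_abs_bound)
  \<comment> \<open>The integrand vanishes off \<open>K\<close>, so the constant \<open>e\<close>
    dominates it on the whole space; hence the total mass in the bound.\<close>
  also have "\<dots> \<le> (LINT x|M. e)"
  proof (rule integral_mono)
    show "integrable M (\<lambda>x. \<bar>indicator K x *\<^sub>R (u x - v x)\<bar>)"
      using int[of "\<lambda>x. u x - v x"] uv
      unfolding set_integrable_def by (intro integrable_abs) (auto intro: continuous_on_diff)
  qed (use e in \<open>auto simp: indicator_def\<close>)
  also have "\<dots> = e * measure M (space M)" by simp
  finally show ?thesis .
qed

lemma objective_mono:
  assumes M: "\<And>i. i \<in> {1..k} \<Longrightarrow> sets (\<mu> i) = sets borel"
      "\<And>i. i \<in> {1..k} \<Longrightarrow> finite_measure (\<mu> i)"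
    and K: "compact K" and l: "\<And>i. i \<in> {1..k} \<Longrightarrow> 0 \<le> l i"
    and F: "\<And>i. i \<in> {1..k} \<Longrightarrow> f i \<in> F a K (l i)" "\<And>i. i \<in> {1..k} \<Longrightarrow> g i \<in> F a K (l i)"
    and le: "\<And>i x. i \<in> {1..k} \<Longrightarrow> x \<in> K \<Longrightarrow>
      S_bar a b K (l i) (f i) x \<le> S_bar a b K (l i) (g i) x"
  shows "objective a b K k \<mu> l f \<le> objective a b K k \<mu> l g"
  unfolding objective_def
proof (rule sum_mono)
  fix i assume i: "i \<in> {1..k}"
  show "(LINT x:K|\<mu> i. S_bar a b K (l i) (f i) x) \<le> (LINT x:K|\<mu> i. S_bar a b K (l i) (g i) x)"
    by (intro set_integral_mono set_integrable_continuous_compact[OF M[OF i] K]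
        S_bar_continuous_on[OF F(1)[OF i] l[OF i] K]
        S_bar_continuous_on[OF F(2)[OF i] l[OF i] K] le[OF i])
qed

lemma objective_diff_bound:
  assumes M: "\<And>i. i \<in> {1..k} \<Longrightarrow> sets (\<mu> i) = sets borel"
      "\<And>i. i \<in> {1..k} \<Longrightarrow> finite_measure (\<mu> i)"
    and K: "compact K" "K \<noteq> {}" and l: "\<And>i. i \<in> {1..k} \<Longrightarrow> 0 \<le> l i"
    and F: "\<And>i. i \<in> {1..k} \<Longrightarrow> f i \<in> F a K (l i)" "\<And>i. i \<in> {1..k} \<Longrightarrow> g i \<in> F a K (l i)"
    and e: "0 \<le> e" "\<And>i x. i \<in> {1..k} \<Longrightarrow> x \<in> K \<Longrightarrow> \<bar>f i x - g i x\<bar> \<le> e"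
  shows "\<bar>objective a b K k \<mu> l f - objective a b K k \<mu> l g\<bar>
    \<le> e * (\<Sum>i=1..k. measure (\<mu> i) (space (\<mu> i)))"
proof -
  have "\<bar>objective a b K k \<mu> l f - objective a b K k \<mu> l g\<bar>
      \<le> (\<Sum>i=1..k. \<bar>(LINT x:K|\<mu> i. S_bar a b K (l i) (f i) x) -
          (LINT x:K|\<mu> i. S_bar a b K (l i) (g i) x)\<bar>)"
    unfolding objective_def sum_subtractf[symmetric] by (rule sum_abs)
  also have "\<dots> \<le> (\<Sum>i=1..k. e * measure (\<mu> i) (space (\<mu> i)))"
  proof (rule sum_mono)
    fix i assume i: "i \<in> {1..k}"
    show "\<bar>(LINT x:K|\<mu> i. S_bar a b K (l i) (f i) x) - (LINT x:K|\<mu> i. S_bar a b K (l i) (g i) x)\<bar>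
      \<le> e * measure (\<mu> i) (space (\<mu> i))"
      by (intro set_integral_diff_bound[OF M(1)[OF i] M(2)[OF i] K(1)]
          S_bar_continuous_on[OF F(1)[OF i] l[OF i] K(1)]
          S_bar_continuous_on[OF F(2)[OF i] l[OF i] K(1)]
          S_bar_nonexpansive[OF F(1)[OF i] F(2)[OF i] l[OF i] K(2)] e(1) e(2)[OF i])
  qed
  finally show ?thesis by (simp add: sum_distrib_left)
qed

section \<open>A compact class of feasible families\<close>

text \<open>The bound by \<open>a\<close> is imposed at all indices and all points, even the
  irrelevant ones, so that the class lies in a product of compact intervals. The other conditions
  are closed under pointwise convergence.\<close>

definition Lipschitz_feasible ::
    "real \<Rightarrow> real \<Rightarrow> 'a::metric_space set \<Rightarrow> nat \<Rightarrow> (nat \<Rightarrow> real) \<Rightarrow> (nat \<Rightarrow> 'a \<Rightarrow> real) set" where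
  "Lipschitz_feasible L a K k l =
     {h. (\<forall>i x. \<bar>h i x\<bar> \<le> a) \<and>
       (\<forall>i\<in>{1..k}. \<forall>x\<in>K. h i x \<le> l i * a) \<and>
       (\<forall>x\<in>K. (\<Sum>i=1..k. h i x) = 0) \<and>
       (\<forall>i\<in>{1..k}. \<forall>x\<in>K. \<forall>y\<in>K. \<bar>h i x - h i y\<bar> \<le> L * dist x y)}"

lemma compact_PiE_UNIV:
  fixes A :: "'i \<Rightarrow> 'b::topological_space set"
  assumes "\<And>i. compact (A i)"
  shows "compact (PiE UNIV A)"
proof -
  have "compactin (product_topology (\<lambda>i. euclidean) UNIV) (PiE UNIV A)"
    using assms by (simp add: compactin_PiE compactin_euclidean_iff)
  then show ?thesis by (simp add: euclidean_product_topology compactin_euclidean_iff)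
qed

lemma continuous_on_eval2: "continuous_on UNIV (\<lambda>h. h i x :: real)"
  by (rule continuous_on_product_then_coordinatewise[OF continuous_on_product_coordinates])

lemma compact_Lipschitz_feasible: "compact (Lipschitz_feasible L a K k l)"
proof -
  \<comment> \<open>Tychonoff is applied twice, over the indices and over the points.\<close>
  have bounded_class: "{h :: nat \<Rightarrow> 'a \<Rightarrow> real. \<forall>i x. \<bar>h i x\<bar> \<le> a} =
      PiE UNIV (\<lambda>_. PiE UNIV (\<lambda>_. {-a..a}))"
    by (auto simp: PiE_UNIV_domain abs_le_iff Pi_iff minus_le_iff[of a])
  have "compact {h :: nat \<Rightarrow> 'a \<Rightarrow> real. \<forall>i x. \<bar>h i x\<bar> \<le> a}" (is "compact ?B")
    unfolding bounded_class by (intro compact_PiE_UNIV compact_Icc)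
  moreover have "closed {h :: nat \<Rightarrow> 'a \<Rightarrow> real.
      (\<forall>i\<in>{1..k}. \<forall>x\<in>K. h i x \<le> l i * a) \<and>
      (\<forall>x\<in>K. (\<Sum>i=1..k. h i x) = 0) \<and>
      (\<forall>i\<in>{1..k}. \<forall>x\<in>K. \<forall>y\<in>K. \<bar>h i x - h i y\<bar> \<le> L * dist x y)}"
    (is "closed ?Q")
    \<comment> \<open>Each condition compares continuous functions of finitely many coordinates, so
      the set is an intersection of closed sets.\<close>
    unfolding Ball_def
    by (intro closed_Collect_conj closed_Collect_all closed_Collect_imp closed_Collect_le
        closed_Collect_eq continuous_intros continuous_on_eval2 open_Collect_const)
  ultimately have "compact (?B \<inter> ?Q)" by (rule compact_Int_closed)
  moreover have "Lipschitz_feasible L a K k l = ?B \<inter> ?Q"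
    unfolding Lipschitz_feasible_def by (rule Collect_conj_eq)
  ultimately show ?thesis by simp
qed

lemma Lipschitz_feasible_subset:
  assumes "compact K" "0 \<le> L"
  shows "Lipschitz_feasible L a K k l \<subseteq> feasible a K k l"
proof
  fix h assume h: "h \<in> Lipschitz_feasible L a K k l"
  have "h i \<in> F a K (l i)" if "i \<in> {1..k}" for i
    by (rule in_F_if_continuous[OF assms(1) continuous_on_if_Lipschitz[OF _ assms(2)]])
      (use h that in \<open>auto simp: Lipschitz_feasible_def\<close>)
  then show "h \<in> feasible a K k l"
    using h by (auto simp: feasible_def Lipschitz_feasible_def)
qed

text \<open>As in the Arzela-Ascoli theorem, closeness at the points of a finite net of
  \<open>K\<close> spreads to all of \<open>K\<close> through the common Lipschitz constant.\<close>

lemma eventually_uniformly_close: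
  fixes h :: "nat \<Rightarrow> 'a::metric_space \<Rightarrow> real"
  assumes K: "compact K" and L: "0 \<le> L" and e: "0 < e" and h: "h \<in> Lipschitz_feasible L a K k l"
  shows "eventually (\<lambda>g. \<forall>i\<in>{1..k}. \<forall>x\<in>K. \<bar>g i x - h i x\<bar> \<le> e)
    (at h within Lipschitz_feasible L a K k l)"
proof -
  let ?C = "Lipschitz_feasible L a K k l"
  \<comment> \<open>The error splits into \<open>e / 4\<close> for moving \<open>g\<close> to a net
    point, \<open>e / 2\<close> there, and \<open>e / 4\<close> for moving \<open>h\<close> back;
    \<open>L + 1\<close> avoids division by zero.\<close>
  define r where "r = e / (4 * (L + 1))"
  have r: "0 < r" using L e by (simp add: r_def)
  have Lr: "L * r \<le> e / 4" using L e by (simp add: r_def field_simps)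
  obtain N where N: "finite N" "N \<subseteq> K" "K \<subseteq> (\<Union>p\<in>N. ball p r)"
    using seq_compact_imp_totally_bounded[OF compact_imp_seq_compact[OF K], rule_format, OF r]
    by (elim exE conjE)
  have coord: "((\<lambda>g. g i p) \<longlongrightarrow> h i p) (at h within ?C)" for i p
    by (rule tendsto_within_subset[OF
          continuous_on_eval2[unfolded continuous_on_def, rule_format, OF UNIV_I] subset_UNIV])
  have "eventually (\<lambda>g. dist (g i p) (h i p) < e / 2) (at h within ?C)" for i p
    using tendstoD[OF coord, of "e / 2"] e by simp
  then have "eventually (\<lambda>g. \<forall>i\<in>{1..k}. \<forall>p\<in>N. dist (g i p) (h i p) < e / 2) (at h within ?C)"
    by (intro eventually_ball_finite N ballI) auto
  moreover have "eventually (\<lambda>g. g \<in> ?C) (at h within ?C)"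
    by (simp add: eventually_at_filter)
  ultimately show ?thesis
  proof eventually_elim
    case (elim g)
    show ?case
    proof (intro ballI)
      fix i x assume i: "i \<in> {1..k}" and x: "x \<in> K"
      obtain p where p: "p \<in> N" "dist p x < r" using N(3) x by auto
      have pK: "p \<in> K" using p N by auto
      have Lp: "L * dist p x \<le> e / 4" using mult_left_mono[OF less_imp_le[OF p(2)] L] Lr by linarith
      have "\<bar>g i p - g i x\<bar> \<le> L * dist p x" "\<bar>h i p - h i x\<bar> \<le> L * dist p x"
        using elim(2) h i x pK by (auto simp: Lipschitz_feasible_def)
      moreover have "\<bar>g i p - h i p\<bar> < e / 2" using elim(1) i p by (auto simp: dist_real_def)
      ultimately show "\<bar>g i x - h i x\<bar> \<le> e" using Lp by linarith
    qed
  qed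
qed

lemma continuous_on_objective:
  assumes M: "\<And>i. i \<in> {1..k} \<Longrightarrow> sets (\<mu> i) = sets borel"
      "\<And>i. i \<in> {1..k} \<Longrightarrow> finite_measure (\<mu> i)"
    and K: "compact K" "K \<noteq> {}" and l: "\<And>i. i \<in> {1..k} \<Longrightarrow> 0 \<le> l i" and L: "0 \<le> L"
  shows "continuous_on (Lipschitz_feasible L a K k l) (objective a b K k \<mu> l)"
  unfolding continuous_on_def
proof (intro ballI tendstoI)
  let ?C = "Lipschitz_feasible L a K k l"
  fix h and e :: real assume h: "h \<in> ?C" and e: "0 < e"
  define m where "m = (\<Sum>i=1..k. measure (\<mu> i) (space (\<mu> i)))"
  have m: "0 \<le> m" unfolding m_def by (rule sum_nonneg) simp
  \<comment> \<open>The total mass \<open>m\<close> may be zero, and \<open>m + 1\<close> also makes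
    \<open>d * m < e\<close> strict.\<close>
  define d where "d = e / (m + 1)"
  have d: "0 < d" using m e by (simp add: d_def)
  have dm: "d * m < e" using m e by (simp add: d_def field_simps)
  have F: "g i \<in> F a K (l i)" if "g \<in> ?C" "i \<in> {1..k}" for g i
    using Lipschitz_feasible_subset[OF K(1) L, of a k l] that by (auto simp: feasible_def)
  have "eventually (\<lambda>g. g \<in> ?C) (at h within ?C)"
    by (simp add: eventually_at_filter)
  with eventually_uniformly_close[OF K(1) L d h]
  show "eventually (\<lambda>g. dist (objective a b K k \<mu> l g) (objective a b K k \<mu> l h) < e)
    (at h within ?C)"
  proof eventually_elim
    case (elim g)
    have "\<bar>objective a b K k \<mu> l g - objective a b K k \<mu> l h\<bar> \<le> d * m"
      unfolding m_def
      by (rule objective_diff_bound[OF M K l F[OF elim(2)] F[OF h]]) (use d elim in auto)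
    then show ?case using dm by (simp add: dist_real_def)
  qed
qed

section \<open>Improving a feasible family to an equi-Lipschitz one\<close>

lemma improve_to_Lipschitz:
  fixes K :: "'a::metric_space set"
  assumes a: "0 < a" and k: "k \<ge> 1"
    and M: "\<And>i. i \<in> {1..k} \<Longrightarrow> sets (\<mu> i) = sets borel"
      "\<And>i. i \<in> {1..k} \<Longrightarrow> finite_measure (\<mu> i)"
    and K: "compact K" "K \<noteq> {}" and l: "\<And>i. i \<in> {1..k} \<Longrightarrow> 0 \<le> l i"
    and l1: "(\<Sum>i=1..k. l i) = 1" and f: "f \<in> feasible a K k l"
  shows "\<exists>h\<in>Lipschitz_feasible (2 * b\<^sup>2 * diameter K) a K k l.
    objective a b K k \<mu> l f \<le> objective a b K k \<mu> l h"
proof -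
  define L where "L = 2 * b\<^sup>2 * diameter K"
  have L: "0 \<le> L" using diameter_ge_0[OF compact_imp_bounded[OF K(1)]] by (simp add: L_def)
  let ?T = "\<lambda>i. S_bar a b K (l i)"
  define g where "g i = ?T i (?T i (f i))" for i
  \<comment> \<open>The last component is forced by the zero sum; the value 0 elsewhere secures the
    global bound of the class.\<close>
  define h where "h i x = (if i \<in> {1..k} \<and> x \<in> K
    then if i < k then g i x else - (\<Sum>j=1..<k. g j x) else 0)" for i x
  have split: "{1..k} = insert k {1..<k}" "k \<notin> {1..<k}" using k by auto
  have sum_split: "(\<Sum>i=1..k. u i) = u k + (\<Sum>i=1..<k. u i)" for u :: "nat \<Rightarrow> real"
    using split by simp
  have fF: "f i \<in> F a K (l i)" if "i \<in> {1..k}" for i using f that by (auto simp: feasible_def)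
  have TF: "?T i (f i) \<in> F a K (l i)" if "i \<in> {1..k}" for i
    by (rule S_bar_in_F[OF fF l K(1)]) (use that in auto)
  have fg: "f i x \<le> g i x" if "i \<in> {1..k}" "x \<in> K" for i x
    unfolding g_def by (rule le_S_bar_S_bar[OF fF l]) (use that in auto)
  have gLip: "\<bar>g i x - g i y\<bar> \<le> l i * (L * dist x y)" if "i \<in> {1..k}" "x \<in> K" "y \<in> K" for i x y
    using S_bar_Lipschitz[OF TF[OF that(1)] l[OF that(1)] compact_imp_bounded[OF K(1)] that(2,3)]
    unfolding g_def L_def by (simp add: mult.assoc)
  \<comment> \<open>Since \<open>g j\<close> has Lipschitz constant \<open>l j * L\<close>, this
    gives the last component the constant \<open>L\<close>, whatever \<open>k\<close> is.\<close>
  have lsum: "(\<Sum>j=1..<k. l j) \<le> 1" using l1 l[of k] k sum_split[of l] by simp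
  have l_le1: "l i \<le> 1" if "i \<in> {1..k}" for i
    using member_le_sum[of i "{1..k}" l] l l1 that by auto
  have h_lt: "h i x = g i x" if "i \<in> {1..<k}" "x \<in> K" for i x using that by (auto simp: h_def)
  have h_k: "h k x = - (\<Sum>j=1..<k. g j x)" if "x \<in> K" for x using that k by (auto simp: h_def)
  have h_sum: "(\<Sum>i=1..k. h i x) = 0" if "x \<in> K" for x
    unfolding sum_split h_k[OF that] using that by (simp add: h_lt)
  have f_k: "f k x = - (\<Sum>j=1..<k. f j x)" if "x \<in> K" for x
  proof -
    have "(\<Sum>i=1..k. f i x) = 0" using f that by (simp add: feasible_def)
    then show ?thesis unfolding sum_split by linarith
  qed
  have hf_k: "h k x \<le> f k x" if "x \<in> K" for x
    using that by (auto simp: h_k f_k intro!: sum_mono fg)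
  have h_upper: "h i x \<le> l i * a" if "i \<in> {1..k}" "x \<in> K" for i x
  proof (cases "i = k")
    case True
    have "f k x \<le> l k * a" using fF[of k] k that by (auto simp: F_def)
    then show ?thesis using hf_k[OF that(2)] True by simp
  next
    case False
    then have "h i x = g i x" using that by (intro h_lt) auto
    then show ?thesis by (simp add: g_def S_bar_le)
  qed
  \<comment> \<open>The lower bound comes from the zero sum: the other components add up to at most
    \<open>(1 - l i) * a\<close>.\<close>
  have h_abs: "\<bar>h i x\<bar> \<le> a" for i x
  proof (cases "i \<in> {1..k} \<and> x \<in> K")
    case True
    have "h i x + (\<Sum>j\<in>{1..k} - {i}. h j x) = 0"
      using h_sum[of x] sum.remove[of "{1..k}" i "\<lambda>j. h j x"] True by auto
    moreover have "(\<Sum>j\<in>{1..k} - {i}. h j x) \<le> (\<Sum>j\<in>{1..k} - {i}. l j * a)"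
      by (rule sum_mono) (use h_upper True in auto)
    moreover have "(\<Sum>j\<in>{1..k} - {i}. l j * a) = (1 - l i) * a"
      using sum.remove[of "{1..k}" i l] True l1 by (auto simp: sum_distrib_right[symmetric])
    moreover have "0 \<le> l i * a" "l i * a \<le> 1 * a"
      using l l_le1 True a by (auto intro!: mult_right_mono)
    moreover have "h i x \<le> l i * a" using h_upper True by auto
    ultimately show ?thesis by (simp add: algebra_simps abs_le_iff)
  next
    case False
    then show ?thesis using a by (auto simp: h_def)
  qed
  have h_Lip: "\<bar>h i x - h i y\<bar> \<le> L * dist x y" if "i \<in> {1..k}" "x \<in> K" "y \<in> K" for i x y
  proof (cases "i = k")
    case True
    have "\<bar>h k x - h k y\<bar> = \<bar>\<Sum>j=1..<k. g j y - g j x\<bar>"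
      using that by (simp add: h_k sum_subtractf)
    also have "\<dots> \<le> (\<Sum>j=1..<k. \<bar>g j y - g j x\<bar>)" by (rule sum_abs)
    also have "\<dots> \<le> (\<Sum>j=1..<k. l j * (L * dist y x))"
      by (rule sum_mono) (use gLip that in auto)
    also have "\<dots> \<le> 1 * (L * dist y x)"
      unfolding sum_distrib_right[symmetric] by (rule mult_right_mono[OF lsum]) (use L in simp)
    finally show ?thesis using True by (simp add: dist_commute)
  next
    case False
    then have "\<bar>h i x - h i y\<bar> \<le> l i * (L * dist x y)" using gLip that by (simp add: h_lt)
    also have "\<dots> \<le> 1 * (L * dist x y)"
      by (rule mult_right_mono[OF l_le1]) (use L that in auto)
    finally show ?thesis by simp
  qed
  have hC: "h \<in> Lipschitz_feasible L a K k l"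
    unfolding Lipschitz_feasible_def using h_abs h_upper h_sum h_Lip by auto
  then have hF: "h i \<in> F a K (l i)" if "i \<in> {1..k}" for i
    using Lipschitz_feasible_subset[OF K(1) L, of a k l] that by (auto simp: feasible_def)
  have "?T i (f i) x \<le> ?T i (h i) x" if i: "i \<in> {1..k}" and x: "x \<in> K" for i x
  proof (cases "i = k")
    case True
    show ?thesis by (rule S_bar_antimono[OF fF l K(2)]) (use i True hf_k in auto)
  next
    case False
    \<comment> \<open>The domination lemma is applied to \<open>?T i (f i)\<close> in place of
      \<open>f i\<close>, since \<open>?T i (g i)\<close> is its double transform.\<close>
    have "?T i (f i) x \<le> ?T i (g i) x"
      unfolding g_def by (rule le_S_bar_S_bar[OF TF l x]) (use i in auto)
    also have "g i \<in> F a K (l i)"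
      unfolding g_def by (rule S_bar_in_F[OF TF l K(1)]) (use i in auto)
    \<comment> \<open>Antitonicity serves as a congruence here: \<open>h i\<close> and
      \<open>g i\<close> agree on \<open>K\<close> but may differ outside it.\<close>
    then have "?T i (g i) x \<le> ?T i (h i) x"
      by (rule S_bar_antimono[OF _ l K(2)]) (use i False h_lt in auto)
    finally show ?thesis .
  qed
  then have "objective a b K k \<mu> l f \<le> objective a b K k \<mu> l h"
    by (intro objective_mono M K l fF hF)
  with hC show ?thesis unfolding L_def by blast
qed

theorem theorem4p10:
  fixes a b :: real and k :: nat
    and \<mu> :: "nat \<Rightarrow> 'a::polish_space measure"
    and l :: "nat \<Rightarrow> real"
    and K :: "'a set"
  assumes "a > 0" and "b > 0" and "k \<ge> 2"
    and "\<And>i. i \<in> {1..k} \<Longrightarrow> sets (\<mu> i) = sets borel"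
    and "\<And>i. i \<in> {1..k} \<Longrightarrow> finite_measure (\<mu> i)"
    and "\<And>i. i \<in> {1..k} \<Longrightarrow> compact (supp (\<mu> i))"
    and "\<And>i. i \<in> {1..k} \<Longrightarrow> l i > 0"
    and "(\<Sum>i=1..k. l i) = 1"
    and "K = (\<Union>i\<in>{1..k}. supp (\<mu> i))"
  shows "\<exists>f\<in>feasible a K k l.
           bdd_above (objective a b K k \<mu> l ` feasible a K k l) \<and>
           objective a b K k \<mu> l f = (SUP g\<in>feasible a K k l. objective a b K k \<mu> l g)"
proof -
  have maximizer: "\<exists>h\<in>feasible a K k l.
      \<forall>g\<in>feasible a K k l. objective a b K k \<mu> l g \<le> objective a b K k \<mu> l h"
  \<comment> \<open>If \<open>K\<close> is empty, as when all measures vanish, each integral over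
    \<open>K\<close> is 0 whatever value the infimum over the empty set has, so the zero family is
    maximal.\<close>
  proof (cases "K = {}")
    case True
    then show ?thesis
      by (intro bexI[of _ "\<lambda>_ _. 0"])
        (auto simp: objective_def feasible_def F_def Cb_def set_lebesgue_integral_def)
  next
    case False
    have K: "compact K" using assms(6,9) by auto
    have l: "0 \<le> l i" if "i \<in> {1..k}" for i using assms(7)[OF that] by simp
    let ?L = "2 * b\<^sup>2 * diameter K"
    let ?C = "Lipschitz_feasible ?L a K k l"
    have L: "0 \<le> ?L" using diameter_ge_0[OF compact_imp_bounded[OF K]] by simp
    have improve: "\<exists>h\<in>?C. objective a b K k \<mu> l g \<le> objective a b K k \<mu> l h"
      if "g \<in> feasible a K k l" for g
      by (rule improve_to_Lipschitz[OF assms(1) _ assms(4,5) K False l assms(8) that])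
        (use assms(3) in auto)
    have "(\<lambda>_ _. 0) \<in> ?C"
      using L l assms(1) by (auto simp: Lipschitz_feasible_def)
    then have nonempty: "?C \<noteq> {}" by blast
    have "continuous_on ?C (objective a b K k \<mu> l)"
      by (rule continuous_on_objective[OF assms(4,5) K False l L])
    then obtain h where h: "h \<in> ?C"
      "\<And>g. g \<in> ?C \<Longrightarrow> objective a b K k \<mu> l g \<le> objective a b K k \<mu> l h"
      using continuous_attains_sup[OF compact_Lipschitz_feasible nonempty] by blast
    \<comment> \<open>Every feasible family is beaten by a member of \<open>?C\<close>, hence by the
      maximizer \<open>h\<close> over \<open>?C\<close>, which is itself feasible.\<close>
    show ?thesis
      using h improve Lipschitz_feasible_subset[OF K L] by (meson order_trans subsetD)
  qed
  then obtain h where h: "h \<in> feasible a K k l"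
    "\<And>g. g \<in> feasible a K k l \<Longrightarrow> objective a b K k \<mu> l g \<le> objective a b K k \<mu> l h"
    by blast
  \<comment> \<open>The maximal value is the supremum and also bounds the image above, so the real
    \<open>SUP\<close> is a genuine supremum.\<close>
  have "(SUP g\<in>feasible a K k l. objective a b K k \<mu> l g) = objective a b K k \<mu> l h"
    by (rule cSup_eq_maximum) (use h in auto)
  moreover have "bdd_above (objective a b K k \<mu> l ` feasible a K k l)"
    using h(2) by (rule bdd_aboveI2)
  ultimately show ?thesis using h(1) by auto
qed

end
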